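(* Let $a_{n,k}$, $1\le k\le n(n+1)/2$, be the roots of the Yablonskii--Vorob'ev polynomial $Q_n(z)$ and let $s_{n,m}=\sum_{k=1}^{n(n+1)/2}(a_{n,k})^m$, $m\ge1$. The following statements are true: 1. at given $n\ge 2$ the functions $s_{n,m}$ with $m>n(n+1)/2$ do not contain any new information about the roots of $Q_n(z)$; 2. $s_{n,3l}$ ($l\in\mathbb{N}$) is a polynomial in $n$ of degree $2(l+1)$.
   Context: Yablonskii--Vorob'ev polynomials: $Q_0(z)=1$, $Q_1(z)=z$, and $Q_{n+1}Q_{n-1}=zQ_n^2-4\left(Q_nQ_n''-(Q_n')^2\right)$. Each $Q_n$ is a monic polynomial with integer coefficients, of degree $n(n+1)/2$, with only simple roots, and for $n\ge1$ the function $w(z;n)=\frac{d}{dz}\ln\frac{Q_{n-1}(z)}{Q_n(z)}$ is a rational solution of the second Painlevé equation $w_{zz}=2w^3+zw+\alpha$ with $\alpha=n$. *)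

theory Defs
  imports Complex_Main "HOL-Computational_Algebra.Computational_Algebra"
begin

text \<open>
  The recurrence has at most one solution in polynomials, since \<open>Q (n - 1)\<close> can be cancelled
  (by degree considerations no \<open>Q n\<close> vanishes); the Yablonskii--Vorob'ev polynomials are that
  solution. Dividing by \<open>Q (n - 1)\<close> with \<open>div\<close> is avoided on purpose, so that the defining
  relation is available as an exact identity.
\<close>
definition yablonskii_vorobev :: "(nat \<Rightarrow> complex poly) \<Rightarrow> bool" where
  "yablonskii_vorobev Q \<longleftrightarrow>
     Q 0 = 1 \<and> Q 1 = [:0, 1:] \<and>
     (\<forall>n\<ge>1. Q (n + 1) * Q (n - 1) =
        [:0, 1:] * (Q n)\<^sup>2 - 4 * (Q n * pderiv (pderiv (Q n)) - (pderiv (Q n))\<^sup>2))"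

definition power_sum :: "complex multiset \<Rightarrow> nat \<Rightarrow> complex" where
  "power_sum A m = (\<Sum>a\<in>#A. a ^ m)"

text \<open>The roots are counted with multiplicity, so that there are \<open>degree (Q n)\<close> of them.\<close>
definition root_power_sum :: "(nat \<Rightarrow> complex poly) \<Rightarrow> nat \<Rightarrow> nat \<Rightarrow> complex" where
  "root_power_sum Q n m = power_sum (proots (Q n)) m"

text \<open>
  Polynomial functions with rational coefficients in the \<open>N\<close> variables \<open>x 1, \<dots>, x N\<close>; values of
  \<open>x\<close> at other indices are not used.
\<close>
inductive_set rat_poly_funs :: "nat \<Rightarrow> ((nat \<Rightarrow> complex) \<Rightarrow> complex) set" for N :: nat where
  const: "(\<lambda>x. of_rat c) \<in> rat_poly_funs N"
| var: "i \<in> {1..N} \<Longrightarrow> (\<lambda>x. x i) \<in> rat_poly_funs N"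
| add: "F \<in> rat_poly_funs N \<Longrightarrow> G \<in> rat_poly_funs N \<Longrightarrow> (\<lambda>x. F x + G x) \<in> rat_poly_funs N"
| mult: "F \<in> rat_poly_funs N \<Longrightarrow> G \<in> rat_poly_funs N \<Longrightarrow> (\<lambda>x. F x * G x) \<in> rat_poly_funs N"

text \<open>
  The value of the \<open>m\<close>-th power sum of the roots of \<open>Q n\<close> carries no information about these roots
  beyond that of the first \<open>N = n (n + 1) / 2\<close> power sums. First: any \<open>N\<close> complex numbers that
  are compatible with the first \<open>N\<close> values are compatible with the \<open>m\<close>-th value. Second: the
  \<open>m\<close>-th value is computed from the first \<open>N\<close> ones by a polynomial \<open>F\<close>. Here \<open>F\<close> has to work for
  the power sums of arbitrary \<open>N\<close> numbers; without this requirement, a constant \<open>F\<close> would do,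
  because the power sums of the roots of a fixed \<open>Q n\<close> are just rational numbers.
\<close>
definition no_new_information :: "(nat \<Rightarrow> complex poly) \<Rightarrow> nat \<Rightarrow> nat \<Rightarrow> bool" where
  "no_new_information Q n m \<longleftrightarrow>
     (let N = n * (n + 1) div 2 in
       (\<forall>A. size A = N \<and> (\<forall>j\<in>{1..N}. power_sum A j = root_power_sum Q n j)
            \<longrightarrow> power_sum A m = root_power_sum Q n m) \<and>
       (\<exists>F\<in>rat_poly_funs N.
            (\<forall>A. size A = N \<longrightarrow> power_sum A m = F (power_sum A)) \<and>
            root_power_sum Q n m = F (root_power_sum Q n)))"

end

theory Submission
  imports Defs
begin

text \<open>
  Let \<open>F\<^sub>n(t) = \<Sum>\<^sub>m s\<^sub>n\<^sub>,\<^sub>m t\<^sup>m\<close>, so that \<open>z Q\<^sub>n' / Q\<^sub>n = F\<^sub>n(1/z)\<close> at infinity. Dividing the defining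
  relation by \<open>Q\<^sub>n\<^sup>2\<close> turns it into \<open>Q\<^sub>n\<^sub>+\<^sub>1 Q\<^sub>n\<^sub>-\<^sub>1 / Q\<^sub>n\<^sup>2 = z Y\<^sub>n\<close> with
  \<open>Y\<^sub>n = 1 + 4 t\<^sup>3 (F\<^sub>n + t F\<^sub>n')\<close>, and its logarithmic derivative is
  \<open>Y\<^sub>n (F\<^sub>n\<^sub>+\<^sub>1 - 2 F\<^sub>n + F\<^sub>n\<^sub>-\<^sub>1) = Y\<^sub>n - t Y\<^sub>n'\<close>. Comparing coefficients expresses the second
  difference in \<open>n\<close> of \<open>s\<^sub>n\<^sub>,\<^sub>m\<close> through \<open>s\<^sub>n\<^sub>,\<^sub>j\<close> and its second differences with \<open>j < m\<close>. By induction the second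
  difference of \<open>s\<^sub>n\<^sub>,\<^sub>3\<^sub>l\<close> is a polynomial of degree \<open>2l\<close>; there is no cancellation in the leading
  coefficient because every contribution to it has the sign \<open>(-1)\<^sup>l\<close>. Summing twice gives degree
  \<open>2l + 2\<close>. This replaces the expansion of \<open>w(z;n)\<close> from the second Painleve equation.

  For the first statement, Newton's identities compute the coefficients of \<open>\<Prod>(1 - a t)\<close> from the first
  \<open>N\<close> power sums of \<open>N\<close> numbers, and then all later power sums from these.
\<close>

section \<open>Newton's identities\<close>

text \<open>This is the expansion of the sum of \<open>1 / (1 - a t)\<close> over \<open>A\<close>;
  the constant term counts the elements.\<close>

definition power_sum_fps :: "complex multiset \<Rightarrow> complex fps" where
  "power_sum_fps A = Abs_fps (power_sum A)"

lemma power_sum_fps_nth [simp]: "power_sum_fps A $ m = power_sum A m"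
  by (simp add: power_sum_fps_def)

lemma power_sum_simps [simp]:
  "power_sum {#} m = 0"
  "power_sum (add_mset a A) m = a ^ m + power_sum A m"
  by (simp_all add: power_sum_def)

lemma power_sum_0 [simp]: "power_sum A 0 = of_nat (size A)"
  by (induction A) simp_all

lemma power_sum_fps_empty [simp]: "power_sum_fps {#} = 0"
  by (rule fps_ext) simp

lemma power_sum_fps_add_mset:
  "power_sum_fps (add_mset a A) = Abs_fps (\<lambda>m. a ^ m) + power_sum_fps A"
  by (rule fps_ext) simp

lemma fps_geometric_mult:
  fixes a :: "'a::comm_ring_1"
  shows "(1 - fps_const a * fps_X) * Abs_fps (\<lambda>m. a ^ m) = 1"
proof (rule fps_ext)
  fix n
  show "((1 - fps_const a * fps_X) * Abs_fps (\<lambda>m. a ^ m)) $ n = (1 :: 'a fps) $ n"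
    by (cases n) (simp_all add: left_diff_distrib mult.assoc)
qed

text \<open>Its coefficients are the elementary symmetric functions of \<open>A\<close> with alternating signs.\<close>
definition elem_fps :: "complex multiset \<Rightarrow> complex fps" where
  "elem_fps A = (\<Prod>a\<in>#A. 1 - fps_const a * fps_X)"

text \<open>Logarithmic derivative of the product, with denominators cleared: each factor
  contributes \<open>- a t / (1 - a t) = 1 - 1 / (1 - a t)\<close>.\<close>

lemma elem_fps_deriv:
  "fps_X * fps_deriv (elem_fps A) = elem_fps A * (of_nat (size A) - power_sum_fps A)"
proof (induction A)
  case empty
  show ?case by (simp add: elem_fps_def)
next
  case (add a A)
  define R where "R = elem_fps A"
  define g where "g = Abs_fps (\<lambda>m. a ^ m)"
  define u where "u = 1 - fps_const a * fps_X"
  have g: "u * g = 1"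
    unfolding u_def g_def by (rule fps_geometric_mult)
  have R: "elem_fps (add_mset a A) = u * R"
    by (simp add: elem_fps_def R_def u_def)
  have u': "fps_X * fps_deriv u = u - 1"
    by (simp add: u_def mult.commute)
  have "fps_X * fps_deriv (u * R) = u * (fps_X * fps_deriv R) + (fps_X * fps_deriv u) * R"
    by (simp add: algebra_simps)
  \<comment> \<open>The 1 in \<open>u - 1\<close> is written as \<open>u * g\<close>, so that
    \<open>u\<close> can be factored out.\<close>
  also have "\<dots> = u * (R * (of_nat (size A) - power_sum_fps A)) + (u - u * g) * R"
    using add by (simp add: R_def u' g)
  also have "\<dots> = (u * R) * (of_nat (size (add_mset a A)) - power_sum_fps (add_mset a A))"
    unfolding power_sum_fps_add_mset g_def[symmetric] by (simp add: algebra_simps)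
  finally show ?case unfolding R .
qed

lemma elem_fps_0 [simp]: "elem_fps A $ 0 = 1"
  by (induction A) (simp_all add: elem_fps_def)

lemma elem_fps_eq_0: "size A < m \<Longrightarrow> elem_fps A $ m = 0"
proof (induction A arbitrary: m)
  case empty
  then show ?case by (simp add: elem_fps_def)
next
  case (add a A)
  then obtain k where "m = Suc k" "size A < k" by (cases m) auto
  then show ?case using add.IH
    by (simp add: elem_fps_def left_diff_distrib mult.assoc)
qed

text \<open>Comparison of coefficients in \<open>elem_fps_deriv\<close>. The term
  \<open>k = m\<close> of the convolution carries \<open>power_sum A 0 = size A\<close> and cancels
  against the term with \<open>of_nat (size A)\<close>.\<close>

lemma newton_identity:
  assumes "m > 0"
  shows "of_nat m * elem_fps A $ m = - (\<Sum>k<m. elem_fps A $ k * power_sum A (m - k))"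
proof -
  have "of_nat m * elem_fps A $ m = (fps_X * fps_deriv (elem_fps A)) $ m"
    using assms by (cases m) simp_all
  also have "\<dots> = (elem_fps A * of_nat (size A)) $ m - (elem_fps A * power_sum_fps A) $ m"
    unfolding elem_fps_deriv by (simp add: right_diff_distrib)
  also have "(elem_fps A * of_nat (size A)) $ m = elem_fps A $ m * of_nat (size A)"
    by (simp add: fps_of_nat[symmetric])
  also have "(elem_fps A * power_sum_fps A) $ m
      = (\<Sum>k<m. elem_fps A $ k * power_sum A (m - k)) + elem_fps A $ m * of_nat (size A)"
    by (simp add: fps_mult_nth atLeast0AtMost lessThan_Suc_atMost[symmetric])
  finally show ?thesis by simp
qed

section \<open>Polynomial dependence on the first \<open>N\<close> power sums\<close>

lemma rat_poly_funs_sum: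
  "finite I \<Longrightarrow> (\<And>i. i \<in> I \<Longrightarrow> f i \<in> rat_poly_funs N) \<Longrightarrow>
    (\<lambda>x. \<Sum>i\<in>I. f i x) \<in> rat_poly_funs N"
proof (induction I rule: finite_induct)
  case empty
  then show ?case using rat_poly_funs.const[of 0 N] by simp
next
  case (insert i I)
  then show ?case using rat_poly_funs.add[of "f i" N "\<lambda>x. \<Sum>i\<in>I. f i x"] by simp
qed

lemma rat_poly_funs_uminus:
  assumes "F \<in> rat_poly_funs N"
  shows "(\<lambda>x. - F x) \<in> rat_poly_funs N"
  using rat_poly_funs.mult[OF rat_poly_funs.const[of "-1"] assms] by simp

lemma rat_poly_funs_cong:
  assumes "F \<in> rat_poly_funs N" "\<And>i. i \<in> {1..N} \<Longrightarrow> x i = y i"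
  shows "F x = F y"
  using assms by (induction rule: rat_poly_funs.induct) auto

text \<open>Newton's identity is solved for the coefficient of index \<open>k\<close>. The division
  by \<open>k\<close> is what makes the coefficients rational rather than integral.\<close>

lemma elem_fps_rat_poly_fun:
  assumes "k \<le> N"
  shows "\<exists>F\<in>rat_poly_funs N. \<forall>A. elem_fps A $ k = F (power_sum A)"
  using assms
proof (induction k rule: less_induct)
  case (less k)
  show ?case
  proof (cases "k = 0")
    case True
    then show ?thesis
      by (intro bexI[OF _ rat_poly_funs.const[of 1]]) simp
  next
    case False
    have "\<forall>i\<in>{..<k}. \<exists>F\<in>rat_poly_funs N. \<forall>A. elem_fps A $ i = F (power_sum A)"
      using less by auto
    then obtain E where E: "\<And>i. i < k \<Longrightarrow> E i \<in> rat_poly_funs N"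
      "\<And>i A. i < k \<Longrightarrow> elem_fps A $ i = E i (power_sum A)"
      by (metis lessThan_iff)
    let ?S = "\<lambda>x. \<Sum>i<k. E i x * x (k - i)"
    have S: "?S \<in> rat_poly_funs N"
      using less.prems E(1)
      by (intro rat_poly_funs_sum rat_poly_funs.mult rat_poly_funs.var) auto
    have "elem_fps A $ k = of_rat (- inverse (of_nat k)) * ?S (power_sum A)" for A
    proof -
      have *: "of_nat k * elem_fps A $ k = - ?S (power_sum A)"
        using newton_identity[of k A] False E(2) by simp
      have "of_rat (- inverse (of_nat k)) * ?S (power_sum A)
          = inverse (of_nat k) * (of_nat k * elem_fps A $ k)"
        unfolding * by (simp only: of_rat_minus of_rat_inverse of_rat_of_nat_eq) simp
      then show ?thesis
        using False by simp
    qed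
    then show ?thesis
      using rat_poly_funs.mult[OF rat_poly_funs.const S] by fastforce
  qed
qed

text \<open>For \<open>m > N = size A\<close> the left side of Newton's identity vanishes, and so do
  its terms with \<open>k > N\<close>. The term \<open>k = 0\<close> is the power sum sought, and
  the others involve only smaller indices \<open>m - k\<close>.\<close>

lemma power_sum_rat_poly_fun:
  assumes "m > 0"
  shows "\<exists>F\<in>rat_poly_funs N. \<forall>A. size A = N \<longrightarrow> power_sum A m = F (power_sum A)"
  using assms
proof (induction m rule: less_induct)
  case (less m)
  show ?case
  proof (cases "m \<le> N")
    case True
    then show ?thesis
      using less.prems by (intro bexI[OF _ rat_poly_funs.var[of m]]) auto
  next
    case False
    have "\<forall>j\<in>{1..<m}. \<exists>F\<in>rat_poly_funs N. \<forall>A. size A = N \<longrightarrow> power_sum A j = F (power_sum A)"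
      using less by auto
    then obtain P where P: "\<And>j. j \<in> {1..<m} \<Longrightarrow> P j \<in> rat_poly_funs N"
      "\<And>j A. j \<in> {1..<m} \<Longrightarrow> size A = N \<Longrightarrow> power_sum A j = P j (power_sum A)"
      by metis
    have "\<forall>k\<in>{1..N}. \<exists>F\<in>rat_poly_funs N. \<forall>A. elem_fps A $ k = F (power_sum A)"
      using elem_fps_rat_poly_fun by auto
    then obtain E where E: "\<And>k. k \<in> {1..N} \<Longrightarrow> E k \<in> rat_poly_funs N"
      "\<And>k A. k \<in> {1..N} \<Longrightarrow> elem_fps A $ k = E k (power_sum A)"
      by metis
    let ?S = "\<lambda>x. \<Sum>k\<in>{1..N}. E k x * P (m - k) x"
    have S: "?S \<in> rat_poly_funs N"
      using False E(1) P(1)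
      by (intro rat_poly_funs_sum rat_poly_funs.mult) auto
    have "power_sum A m = - ?S (power_sum A)" if "size A = N" for A
    proof -
      have "(\<Sum>k<m. elem_fps A $ k * power_sum A (m - k)) = 0"
        using newton_identity[of m A] less.prems False that elem_fps_eq_0[of A m] by simp
      moreover have "(\<Sum>k<m. elem_fps A $ k * power_sum A (m - k))
          = (\<Sum>k\<in>{0..N}. elem_fps A $ k * power_sum A (m - k))"
        using False that
        by (intro sum.mono_neutral_right) (auto simp: elem_fps_eq_0)
      moreover have "\<dots> = power_sum A m + (\<Sum>k\<in>{1..N}. elem_fps A $ k * power_sum A (m - k))"
        by (simp add: sum.atLeast_Suc_atMost)
      moreover have "(\<Sum>k\<in>{1..N}. elem_fps A $ k * power_sum A (m - k)) = ?S (power_sum A)"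
        using False that E(2) P(2) by (intro sum.cong refl) auto
      ultimately show ?thesis
        by (simp add: eq_neg_iff_add_eq_0)
    qed
    then show ?thesis
      using rat_poly_funs_uminus[OF S] by (intro bexI) auto
  qed
qed

text \<open>One \<open>F\<close> serves both requirements: since it reads only the values at
  \<open>1..N\<close>, agreement there forces agreement at \<open>m\<close>.\<close>

lemma no_new_informationI:
  assumes size: "size (proots (Q n)) = n * (n + 1) div 2" and "m > 0"
  shows "no_new_information Q n m"
proof -
  define N where "N = n * (n + 1) div 2"
  obtain F where F: "F \<in> rat_poly_funs N"
    "\<And>A. size A = N \<Longrightarrow> power_sum A m = F (power_sum A)"
    using power_sum_rat_poly_fun[OF \<open>m > 0\<close>] by blast
  have root: "root_power_sum Q n m = F (root_power_sum Q n)"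
    using F(2)[of "proots (Q n)"] size by (simp add: root_power_sum_def[abs_def] N_def)
  have "power_sum A m = root_power_sum Q n m"
    if "size A = N" "\<forall>j\<in>{1..N}. power_sum A j = root_power_sum Q n j" for A
    using F(2)[OF that(1)] root rat_poly_funs_cong[OF F(1)] that(2) by metis
  then show ?thesis
    using F root unfolding no_new_information_def Let_def N_def[symmetric] by blast
qed

section \<open>Expansion of polynomials at infinity\<close>

text \<open>The Laurent series variable stands for \<open>t = 1/z\<close>.\<close>
definition fls_at_infinity :: "'a::comm_ring_1 poly \<Rightarrow> 'a fls" where
  "fls_at_infinity p = poly (map_poly fls_const p) fls_X_inv"

lemma fls_at_infinity_pCons:
  "fls_at_infinity (pCons c p) = fls_const c + fls_X_inv * fls_at_infinity p"
  by (simp add: fls_at_infinity_def map_poly_pCons)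

lemma fls_at_infinity_0 [simp]: "fls_at_infinity 0 = 0"
  by (simp add: fls_at_infinity_def)

lemma fls_at_infinity_add:
  "fls_at_infinity (p + q) = fls_at_infinity p + fls_at_infinity q"
proof (induction p arbitrary: q)
  case (pCons a p)
  then show ?case
    by (cases q) (simp add: fls_at_infinity_pCons fls_plus_const[symmetric] algebra_simps)
qed simp

lemma fls_at_infinity_smult:
  "fls_at_infinity (smult c p) = fls_const c * fls_at_infinity p"
  by (induction p) (simp_all add: fls_at_infinity_pCons algebra_simps flip: fls_const_mult_const)

lemma fls_at_infinity_mult:
  "fls_at_infinity (p * q) = fls_at_infinity p * fls_at_infinity q"
  by (induction p) (simp_all add: fls_at_infinity_pCons fls_at_infinity_add
      fls_at_infinity_smult algebra_simps)

lemma fls_at_infinity_diff: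
  "fls_at_infinity (p - q) = fls_at_infinity p - fls_at_infinity q"
  using fls_at_infinity_add[of "p - q" q] by simp

lemma fls_at_infinity_numeral: "fls_at_infinity (numeral c) = numeral c"
  by (simp add: numeral_poly fls_at_infinity_pCons)

lemma fls_at_infinity_X: "fls_at_infinity [:0, 1:] = fls_X_inv"
  by (simp add: fls_at_infinity_pCons)

lemma fls_at_infinity_power:
  "fls_at_infinity (p ^ k) = fls_at_infinity p ^ k"
proof (induction k)
  case 0
  show ?case by (simp add: one_pCons fls_at_infinity_pCons)
qed (simp add: fls_at_infinity_mult)

lemma fls_X_mult_X_inv: "fls_X * fls_X_inv = (1 :: 'a::comm_ring_1 fls)"
  by (simp add: fls_X_inv_times_conv_shift mult.commute)

text \<open>The operator \<open>z d/dz = - t d/dt\<close>.\<close>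
definition euler_fls :: "'a::comm_ring_1 fls \<Rightarrow> 'a fls" where
  "euler_fls f = - (fls_X * fls_deriv f)"

lemma euler_fls_simps:
  "euler_fls (f + g) = euler_fls f + euler_fls g"
  "euler_fls (f * g) = euler_fls f * g + f * euler_fls g"
  "euler_fls (fls_const c) = 0"
  by (simp_all add: euler_fls_def algebra_simps)

lemma euler_fls_X_inv: "euler_fls fls_X_inv = fls_X_inv"
  by (simp add: euler_fls_def power2_eq_square fls_X_mult_X_inv flip: mult.assoc)

lemma euler_fls_fps: "euler_fls (fps_to_fls f) = fps_to_fls (- (fps_X * fps_deriv f))"
  by (simp add: euler_fls_def fls_deriv_fps_to_fls fls_times_fps_to_fls)

text \<open>Links the derivation on series in \<open>t\<close> with the derivative of polynomials in
  \<open>z\<close>; the factor \<open>fls_X_inv\<close> stands for \<open>z\<close>.\<close>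

lemma euler_fls_at_infinity:
  "euler_fls (fls_at_infinity p) = fls_X_inv * fls_at_infinity (pderiv p)"
proof (induction p)
  case 0
  show ?case by (simp add: euler_fls_def)
next
  case (pCons a p)
  then show ?case
    by (simp add: fls_at_infinity_pCons euler_fls_simps euler_fls_X_inv pderiv_pCons
        fls_at_infinity_add algebra_simps)
qed

text \<open>A factor \<open>z - a = z (1 - a t)\<close> has logarithmic derivative
  \<open>z / (z - a) = 1 / (1 - a t)\<close>, a geometric series in \<open>t\<close>; these add up
  over \<open>A\<close>.\<close>

lemma euler_fls_linear_factors:
  defines "q \<equiv> \<lambda>A. fls_at_infinity (\<Prod>a\<in>#A. [:-a, 1:])"
  shows "euler_fls (q A) = q A * fps_to_fls (power_sum_fps A)"
proof (induction A)
  case empty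
  show ?case by (simp add: q_def one_pCons fls_at_infinity_pCons euler_fls_def)
next
  case (add a A)
  define g where "g = fps_to_fls (Abs_fps (\<lambda>m. a ^ m))"
  define u where "u = fls_X_inv - fls_const a"
  have u: "u = fls_X_inv * fps_to_fls (1 - fps_const a * fps_X)"
    using fls_X_mult_X_inv[where 'a = complex]
    by (simp add: u_def right_diff_distrib fls_times_fps_to_fls mult.left_commute mult.commute)
  have ug: "u * g = fls_X_inv"
    unfolding u g_def mult.assoc fls_times_fps_to_fls[symmetric] fps_geometric_mult by simp
  have "euler_fls u = fls_X_inv"
    using euler_fls_simps(1)[of fls_X_inv "fls_const (-a)"] euler_fls_simps(3)[of "-a"]
    by (simp add: u_def euler_fls_X_inv)
  moreover have "q (add_mset a A) = u * q A"
    by (simp add: q_def fls_at_infinity_mult fls_at_infinity_pCons u_def del: mult_pCons_left)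
  ultimately have "euler_fls (q (add_mset a A))
      = u * g * q A + u * (q A * fps_to_fls (power_sum_fps A))"
    using add ug by (simp add: euler_fls_simps)
  also have "\<dots> = u * q A * fps_to_fls (power_sum_fps (add_mset a A))"
    by (simp add: power_sum_fps_add_mset g_def algebra_simps)
  finally show ?case using \<open>q (add_mset a A) = u * q A\<close> by simp
qed

lemma euler_fls_monic:
  assumes "lead_coeff p = 1"
  shows "euler_fls (fls_at_infinity p) = fls_at_infinity p * fps_to_fls (power_sum_fps (proots p))"
  using euler_fls_linear_factors[of "proots p"] complex_poly_decompose_multiset[of p] assms by simp

text \<open>Needed to cancel \<open>Q\<^sup>2\<close> later. Each linear factor has coefficient 1 at
  \<open>1/t\<close>, and Laurent series over a field have no zero divisors.\<close>

lemma fls_at_infinity_monic_nonzero: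
  fixes p :: "complex poly"
  assumes "lead_coeff p = 1"
  shows "fls_at_infinity p \<noteq> 0"
proof -
  have "fls_at_infinity (\<Prod>a\<in>#A. [:-a, 1:]) \<noteq> 0" for A :: "complex multiset"
  proof (induction A)
    case empty
    show ?case by (simp add: one_pCons fls_at_infinity_pCons)
  next
    case (add a A)
    have "fls_nth (fls_at_infinity [:-a, 1:]) (-1) \<noteq> 0"
      by (simp add: fls_at_infinity_pCons)
    then have "fls_at_infinity [:-a, 1:] \<noteq> 0" by auto
    then show ?case using add
      by (simp add: fls_at_infinity_mult del: mult_pCons_left)
  qed
  from this[of "proots p"] show ?thesis
    using complex_poly_decompose_multiset[of p] assms by simp
qed

section \<open>The Toda-type relation for power sums\<close>

text \<open>With \<open>Q'/Q = t F\<close> and \<open>d/dz = - t^2 d/dt\<close>, this is the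
  expansion of \<open>1 - (4/z) (Q'/Q)'\<close>.\<close>

definition toda_fps :: "complex fps \<Rightarrow> complex fps" where
  "toda_fps F = 1 + 4 * fps_X ^ 3 * (F + fps_X * fps_deriv F)"

lemma toda_power_sum_fps:
  assumes rec: "P * R = [:0, 1:] * Q\<^sup>2 - 4 * (Q * pderiv (pderiv Q) - (pderiv Q)\<^sup>2)"
    and monic: "lead_coeff P = 1" "lead_coeff Q = 1" "lead_coeff R = 1"
  defines "F \<equiv> \<lambda>p. power_sum_fps (proots p)"
  defines "Y \<equiv> toda_fps (F Q)"
  shows "Y * (F P - 2 * F Q + F R) = Y - fps_X * fps_deriv Y"
proof -
  define x t :: "complex fls" where "x = fls_X_inv" and "t = fls_X"
  define q d e p r where "q = fls_at_infinity Q" and "d = fls_at_infinity (pderiv Q)"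
    and "e = fls_at_infinity (pderiv (pderiv Q))"
    and "p = fls_at_infinity P" and "r = fls_at_infinity R"
  define f g h where "f = fps_to_fls (F Q)" and "g = fps_to_fls (F P)" and "h = fps_to_fls (F R)"
  define y where "y = fps_to_fls Y"
  have tx: "t * x = 1"
    unfolding t_def x_def by (rule fls_X_mult_X_inv)
  have xd: "x * d = q * f"
    using euler_fls_at_infinity[of Q] euler_fls_monic[OF monic(2)]
    by (simp add: x_def d_def q_def f_def F_def)
  have q: "euler_fls q = q * f" and p: "euler_fls p = p * g" and r: "euler_fls r = r * h"
    using euler_fls_monic monic by (simp_all add: q_def f_def p_def g_def r_def h_def F_def)
  have d: "euler_fls d = x * e"
    unfolding d_def e_def x_def by (rule euler_fls_at_infinity)
  have x: "euler_fls x = x"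
    unfolding x_def by (rule euler_fls_X_inv)
  \<comment> \<open>Applying \<open>z d/dz\<close> to \<open>z Q' = Q F\<close> expresses
    \<open>z^2 Q''\<close> through \<open>Q\<close> and \<open>F\<close>.\<close>
  have "euler_fls (x * d) = euler_fls (q * f)"
    using xd by simp
  then have "x * d + x * (x * e) = q * f * f + q * euler_fls f"
    by (simp add: euler_fls_simps x d q)
  then have x2e: "x\<^sup>2 * e = q * (f\<^sup>2 + euler_fls f - f)"
    using xd by (simp add: algebra_simps power2_eq_square)
  have y_eq: "y = 1 - 4 * t ^ 3 * (euler_fls f - f)"
    unfolding y_def Y_def toda_fps_def f_def euler_fls_fps t_def
    by (simp add: fls_times_fps_to_fls fps_to_fls_power algebra_simps)
  have "p * r = x * q\<^sup>2 - 4 * (q * e - d\<^sup>2)"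
    using arg_cong[OF rec, of fls_at_infinity]
    by (simp add: fls_at_infinity_mult fls_at_infinity_diff fls_at_infinity_power
        fls_at_infinity_numeral fls_at_infinity_X p_def r_def q_def d_def e_def x_def
        del: mult_pCons_left)
  \<comment> \<open>The factor \<open>x\<^sup>2\<close> makes the derivatives occur only as
    \<open>x\<^sup>2 * e\<close> and \<open>x * d\<close>, which are multiples of \<open>q\<close>.
    It is removed afterwards by \<open>t * x = 1\<close>.\<close>
  then have "x\<^sup>2 * (p * r) = x\<^sup>2 * (x * q\<^sup>2 - 4 * (q * e - d\<^sup>2))"
    by simp
  also have "\<dots> = x ^ 3 * q\<^sup>2 - 4 * (q * (x\<^sup>2 * e) - (x * d)\<^sup>2)"
    by (simp add: algebra_simps power2_eq_square power3_eq_cube)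
  also have "\<dots> = q\<^sup>2 * (x ^ 3 - 4 * (euler_fls f - f))"
    unfolding x2e xd by (simp add: algebra_simps power2_eq_square)
  finally have x2pr: "x\<^sup>2 * (p * r) = q\<^sup>2 * (x ^ 3 - 4 * (euler_fls f - f))" .
  have "p * r = (t * x)\<^sup>2 * (p * r)"
    by (simp add: tx)
  also have "\<dots> = t\<^sup>2 * (x\<^sup>2 * (p * r))"
    by (simp add: power_mult_distrib)
  also have "\<dots> = q\<^sup>2 * ((t * x)\<^sup>2 * x - 4 * t\<^sup>2 * (euler_fls f - f))"
    unfolding x2pr by (simp add: algebra_simps power2_eq_square power3_eq_cube)
  also have "\<dots> = q\<^sup>2 * (x - 4 * t\<^sup>2 * (t * x) * (euler_fls f - f))"
    by (simp add: tx)
  also have "\<dots> = q\<^sup>2 * (x * y)"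
    unfolding y_eq by (simp add: algebra_simps power2_eq_square power3_eq_cube)
  finally have pr: "p * r = q\<^sup>2 * (x * y)" .
  then have "euler_fls (p * r) = euler_fls (q\<^sup>2 * (x * y))"
    by simp
  \<comment> \<open>Logarithmic derivatives of both sides: \<open>q\<^sup>2\<close> contributes
    \<open>2 * f\<close>, and \<open>x\<close> contributes the 1.\<close>
  then have "p * r * (g + h) = q\<^sup>2 * x * (y * (2 * f + 1) + euler_fls y)"
    by (simp add: power2_eq_square euler_fls_simps p q r x algebra_simps)
  then have "q\<^sup>2 * x * (y * (g - 2 * f + h)) = q\<^sup>2 * x * (y + euler_fls y)"
    unfolding pr by (simp add: algebra_simps)
  moreover have "q\<^sup>2 * x \<noteq> 0"
    using fls_at_infinity_monic_nonzero[OF monic(2)] by (simp add: q_def x_def)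
  ultimately have "y * (g - 2 * f + h) = y + euler_fls y"
    using mult_left_cancel by blast
  then have "fps_to_fls (Y * (F P - 2 * F Q + F R)) = fps_to_fls (Y - fps_X * fps_deriv Y)"
    by (simp add: y_def euler_fls_fps f_def g_def h_def fls_times_fps_to_fls)
  then show ?thesis by (simp only: fps_to_fls_eq_iff)
qed

lemma toda_fps_nth:
  "toda_fps F $ m = (if m = 0 then 1 else if m < 3 then 0 else 4 * of_nat (m - 2) * F $ (m - 3))"
proof -
  have "(4 * fps_X ^ 3 * (F + fps_X * fps_deriv F)) $ m
      = 4 * (fps_X ^ 3 * (F + fps_X * fps_deriv F)) $ m"
    by (simp add: mult.assoc numeral_fps_const)
  moreover have "(F + fps_X * fps_deriv F) $ k = of_nat (k + 1) * F $ k" for k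
    by (cases k) (simp_all add: algebra_simps)
  \<comment> \<open>The shift by \<open>fps_X ^ 3\<close> evaluates the factor \<open>k + 1\<close>
    at \<open>k = m - 3\<close>.\<close>
  moreover have "m - 3 + 1 = m - 2" if "m \<ge> 3"
    using that by simp
  ultimately show ?thesis
    by (simp only: toda_fps_def fps_add_nth fps_one_nth fps_X_power_mult_nth) auto
qed

text \<open>Coefficient of \<open>t^m\<close> in \<open>toda_power_sum_fps\<close>. In the
  convolution, \<open>j = 0\<close> gives \<open>D m\<close>, and \<open>j = m\<close> gives
  \<open>y m * D 0 = y m\<close>, which cancels against the \<open>y m\<close> on the right.\<close>

lemma toda_power_sum:
  assumes rec: "P * R = [:0, 1:] * Q\<^sup>2 - 4 * (Q * pderiv (pderiv Q) - (pderiv Q)\<^sup>2)"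
    and monic: "lead_coeff P = 1" "lead_coeff Q = 1" "lead_coeff R = 1"
    and m: "m > 0"
  defines "s \<equiv> \<lambda>p. power_sum (proots p)"
  defines "y \<equiv> \<lambda>m. toda_fps (power_sum_fps (proots Q)) $ m"
  defines "D \<equiv> \<lambda>m. s P m - 2 * s Q m + s R m"
  assumes D0: "D 0 = 1"
  shows "D m = - of_nat m * y m - (\<Sum>j\<in>{1..<m}. y j * D (m - j))"
proof -
  let ?Y = "toda_fps (power_sum_fps (proots Q))"
  define E where
    "E = power_sum_fps (proots P) - 2 * power_sum_fps (proots Q) + power_sum_fps (proots R)"
  have D: "E $ k = D k" for k
    by (simp add: E_def D_def s_def numeral_fps_const)
  have lhs: "(?Y * E) $ m = y m - of_nat m * y m"
    unfolding E_def toda_power_sum_fps[OF rec monic] using m by (cases m) (simp_all add: y_def)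
  have "(?Y * E) $ m = (\<Sum>j=0..m. y j * D (m - j))"
    unfolding fps_mult_nth D y_def ..
  also have "{0..m} = insert 0 (insert m {1..<m})"
    using m by auto
  also have "(\<Sum>j\<in>\<dots>. y j * D (m - j)) = D m + y m + (\<Sum>j\<in>{1..<m}. y j * D (m - j))"
    using m D0 by (simp add: y_def toda_fps_nth)
  finally show ?thesis
    unfolding lhs by algebra
qed


section \<open>Sequences given by polynomials\<close>

lemma pcompose_power: "pcompose (p ^ k) q = pcompose p q ^ k"
  by (induction k) (simp_all add: pcompose_mult pcompose_1)

text \<open>Induction on the degree bound: the difference of a suitable monomial removes the top
  term of \<open>p\<close>, and the rest has a smaller bound.\<close>

lemma poly_antidifference:
  fixes p :: "'a::field_char_0 poly"
  assumes "degree p \<le> d"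
  shows "\<exists>P. degree P \<le> Suc d \<and> coeff P (Suc d) = coeff p d / of_nat (Suc d) \<and>
    pcompose P [:1, 1:] - P = p"
  using assms
proof (induction d arbitrary: p)
  case 0
  then obtain c where "p = [:c:]" by (auto elim: degree_eq_zeroE)
  then show ?case by (intro exI[of _ "[:0, c:]"]) (simp add: pcompose_pCons)
next
  case (Suc d)
  define c where "c = coeff p (Suc d) / of_nat (Suc (Suc d))"
  define M where "M = monom c (Suc (Suc d))"
  \<comment> \<open>Lower coefficients are irrelevant, since they go into the remainder
    \<open>r\<close>, to which the induction hypothesis applies.\<close>
  have M: "coeff (pcompose M [:1, 1:] - M) i =
      (if i = Suc d then coeff p (Suc d) else 0)" if "i > d" for i
  proof -
    have "pcompose M [:1, 1:] = smult c ([:1, 1:] ^ Suc (Suc d))"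
      by (simp add: M_def monom_altdef pcompose_smult pcompose_power pcompose_pCons
          del: power_Suc)
    moreover have "coeff ([:1, 1:] ^ Suc (Suc d)) i = (of_nat (Suc (Suc d) choose i) :: 'a)"
    proof (cases "i \<le> Suc (Suc d)")
      case True
      then show ?thesis by (simp add: coeff_linear_poly_power del: power_Suc)
    next
      case False
      then have "degree ([:1, 1:] ^ Suc (Suc d) :: 'a poly) < i"
        by (simp add: degree_linear_power del: power_Suc)
      then show ?thesis using False by (simp add: coeff_eq_0 del: power_Suc)
    qed
    moreover have "Suc (Suc d) choose i = (if i = Suc (Suc d) then 1 else
        if i = Suc d then Suc (Suc d) else 0)"
    proof -
      have "i = Suc d \<or> i = Suc (Suc d) \<or> i > Suc (Suc d)"
        using that by arith
      moreover have "Suc (Suc d) choose Suc d = Suc (Suc d)"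
        using binomial_symmetric[of "Suc d" "Suc (Suc d)"] by (simp del: binomial_Suc_Suc)
      ultimately show ?thesis
        by (elim disjE) (simp_all del: binomial_Suc_Suc)
    qed
    ultimately show ?thesis
      by (auto simp: M_def c_def simp del: power_Suc of_nat_Suc)
  qed
  define r where "r = p - (pcompose M [:1, 1:] - M)"
  have "degree r \<le> d"
  proof (rule degree_le, intro allI impI)
    fix i assume "d < i"
    then have "coeff r i = coeff p i - (if i = Suc d then coeff p (Suc d) else 0)"
      unfolding r_def using M by simp
    then show "coeff r i = 0"
      using Suc.prems \<open>d < i\<close> by (cases "i = Suc d") (auto intro: coeff_eq_0)
  qed
  then obtain P where P: "degree P \<le> Suc d" "pcompose P [:1, 1:] - P = r"
    using Suc.IH by blast
  show ?case
  proof (intro exI conjI)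
    show "degree (M + P) \<le> Suc (Suc d)"
      using P(1) degree_monom_le[of c "Suc (Suc d)"] by (intro degree_add_le) (auto simp: M_def)
    show "coeff (M + P) (Suc (Suc d)) = coeff p (Suc d) / of_nat (Suc (Suc d))"
      using P(1) by (simp add: M_def c_def coeff_eq_0)
    show "pcompose (M + P) [:1, 1:] - (M + P) = p"
      using P(2) by (simp add: r_def pcompose_add algebra_simps)
  qed
qed

text \<open>
  Only an upper bound on the degree, with \<open>c\<close> possibly zero, so that the notion is stable under sums.
\<close>
definition poly_seq :: "nat \<Rightarrow> 'a::field_char_0 \<Rightarrow> (nat \<Rightarrow> 'a) \<Rightarrow> bool" where
  "poly_seq d c f \<longleftrightarrow>
     (\<exists>p. degree p \<le> d \<and> coeff p d = c \<and> (\<forall>n. f n = poly p (of_nat n)))"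

lemma poly_seq_const: "poly_seq 0 c (\<lambda>n. c)"
  unfolding poly_seq_def by (intro exI[of _ "[:c:]"]) simp

lemma poly_seq_zero: "poly_seq d 0 (\<lambda>n. 0)"
  unfolding poly_seq_def by (intro exI[of _ 0]) simp

lemma poly_seq_add:
  "poly_seq d a f \<Longrightarrow> poly_seq d b g \<Longrightarrow> poly_seq d (a + b) (\<lambda>n. f n + g n)"
  unfolding poly_seq_def by (metis coeff_add degree_add_le poly_add)

lemma poly_seq_sum:
  "finite I \<Longrightarrow> (\<And>i. i \<in> I \<Longrightarrow> poly_seq d (a i) (f i)) \<Longrightarrow>
    poly_seq d (\<Sum>i\<in>I. a i) (\<lambda>n. \<Sum>i\<in>I. f i n)"
  by (induction I rule: finite_induct) (simp_all add: poly_seq_zero poly_seq_add)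

lemma poly_seq_mult:
  assumes "poly_seq d a f" "poly_seq e b g"
  shows "poly_seq (d + e) (a * b) (\<lambda>n. f n * g n)"
proof -
  obtain p q where "degree p \<le> d" "coeff p d = a" "\<And>n. f n = poly p (of_nat n)"
    "degree q \<le> e" "coeff q e = b" "\<And>n. g n = poly q (of_nat n)"
    using assms unfolding poly_seq_def by blast
  \<comment> \<open>If one of the degree bounds is strict, both sides are 0.\<close>
  moreover from this have "coeff (p * q) (d + e) = a * b"
    using coeff_mult_degree_sum[of p q]
    by (cases "degree p = d \<and> degree q = e")
      (auto simp: coeff_eq_0 le_less intro!: coeff_eq_0 le_less_trans[OF degree_mult_le])
  ultimately show ?thesis
    unfolding poly_seq_def
    by (intro exI[of _ "p * q"]) (auto intro: order.trans[OF degree_mult_le])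
qed

lemma poly_seq_cmult:
  "poly_seq d a f \<Longrightarrow> poly_seq d (c * a) (\<lambda>n. c * f n)"
  using poly_seq_mult[OF poly_seq_const] by simp

lemma poly_seq_shift:
  assumes "poly_seq d a f"
  shows "poly_seq d a (\<lambda>n. f (Suc n))"
proof -
  obtain p where p: "degree p \<le> d" "coeff p d = a" "\<And>n. f n = poly p (of_nat n)"
    using assms unfolding poly_seq_def by blast
  have "degree (pcompose p [:1, 1:]) = degree p"
    by (simp add: degree_pcompose)
  moreover have "lead_coeff (pcompose p [:1, 1:]) = lead_coeff p"
    by (subst lead_coeff_comp) simp_all
  ultimately have "coeff (pcompose p [:1, 1:]) d = a"
    using p(1,2) by (cases "degree p = d") (auto simp: coeff_eq_0)
  then show ?thesis
    unfolding poly_seq_def using p \<open>degree (pcompose p [:1, 1:]) = degree p\<close>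
    by (intro exI[of _ "pcompose p [:1, 1:]"]) (simp add: poly_pcompose)
qed

lemma poly_seq_antidifference:
  assumes "poly_seq d a (\<lambda>n. f (Suc n) - f n)"
  shows "poly_seq (Suc d) (a / of_nat (Suc d)) f"
proof -
  obtain p where p: "degree p \<le> d" "coeff p d = a" "\<And>n. f (Suc n) - f n = poly p (of_nat n)"
    using assms unfolding poly_seq_def by blast
  obtain P where P: "degree P \<le> Suc d" "coeff P (Suc d) = a / of_nat (Suc d)"
    "pcompose P [:1, 1:] - P = p"
    using poly_antidifference[OF p(1)] p(2) by blast
  \<comment> \<open>The constant adjusts the antidifference to agree with \<open>f\<close> at
    0.\<close>
  define P' where "P' = P + [:f 0 - poly P 0:]"
  have "f n = poly P' (of_nat n)" for n
  proof (induction n)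
    case 0
    show ?case by (simp add: P'_def)
  next
    case (Suc n)
    have "f (Suc n) = poly P' (of_nat n) + poly p (of_nat n)"
      using p(3)[of n] Suc by (simp add: algebra_simps)
    then show ?case
      by (simp add: P'_def poly_pcompose flip: P(3))
  qed
  moreover have "degree P' \<le> Suc d"
    using P(1) by (auto simp: P'_def intro: degree_add_le)
  moreover have "coeff P' (Suc d) = a / of_nat (Suc d)"
    using P(2) by (simp add: P'_def)
  ultimately show ?thesis
    unfolding poly_seq_def by blast
qed

section \<open>Power sums of the roots\<close>

text \<open>The term \<open>z Q\<^sup>2\<close> dominates the right side of the recurrence: it has
  degree \<open>2 * N + 1\<close>, while the terms with derivatives stay within
  \<open>2 * N\<close>.\<close>

lemma yablonskii_vorobev_degree:
  assumes "yablonskii_vorobev Q"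
  shows "degree (Q n) = n * (n + 1) div 2 \<and> lead_coeff (Q n) = 1"
proof (induction n rule: less_induct)
  case (less n)
  note Q = assms[unfolded yablonskii_vorobev_def]
  consider "n = 0" | "n = 1" | k where "n = Suc (Suc k)"
    by (metis One_nat_def not0_implies_Suc)
  then show ?case
  proof cases
    case 1
    then show ?thesis using Q by simp
  next
    case 2
    then show ?thesis using Q by simp
  next
    case 3
    let ?p = "Q (Suc k)"
    define N where "N = degree ?p"
    define r where "r = ?p * pderiv (pderiv ?p) - (pderiv ?p)\<^sup>2"
    have "k < n" using 3 by simp
    have "degree ?p = Suc k * (Suc k + 1) div 2" and lc: "lead_coeff ?p = 1"
      and "degree (Q k) = k * (k + 1) div 2" and lck: "lead_coeff (Q k) = 1"
      using less.IH[of "Suc k"] less.IH[OF \<open>k < n\<close>] 3 by blast+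
    then have N: "2 * N = Suc k * (k + 2)" and k: "2 * degree (Q k) = k * (k + 1)"
      unfolding N_def by simp_all
    have rec: "Q n * Q k = [:0, 1:] * ?p\<^sup>2 - 4 * r"
      using Q 3 unfolding r_def by (metis Suc_eq_plus1 diff_Suc_1 le_add2)
    have "degree r \<le> 2 * N"
      unfolding r_def
    proof (rule degree_diff_le)
      show "degree (?p * pderiv (pderiv ?p)) \<le> 2 * N"
        using degree_mult_le[of ?p "pderiv (pderiv ?p)"] degree_pderiv[of ?p]
          degree_pderiv[of "pderiv ?p"] by (simp add: N_def)
      show "degree ((pderiv ?p)\<^sup>2) \<le> 2 * N"
        using degree_mult_le[of "pderiv ?p" "pderiv ?p"] degree_pderiv[of ?p]
        by (simp add: N_def power2_eq_square)
    qed
    then have r: "degree (4 * r) \<le> 2 * N"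
      using degree_mult_le[of 4 r] by simp
    have p: "?p \<noteq> 0" using lc by auto
    have sq: "degree ([:0, 1:] * ?p\<^sup>2) = 2 * N + 1" "lead_coeff ([:0, 1:] * ?p\<^sup>2) = 1"
      using p lc unfolding lead_coeff_mult lead_coeff_power
      by (simp_all add: degree_mult_eq N_def power2_eq_square del: mult_pCons_left)
    have deg: "degree (Q n * Q k) = 2 * N + 1"
      unfolding rec diff_conv_add_uminus using sq(1) r
      by (subst degree_add_eq_left) (simp_all del: mult_pCons_left)
    have lead: "lead_coeff (Q n * Q k) = 1"
      unfolding deg unfolding rec coeff_diff using sq r
      by (simp add: coeff_eq_0 del: mult_pCons_left)
    then have "Q n \<noteq> 0" "Q k \<noteq> 0" by auto
    then have "degree (Q n) + degree (Q k) = 2 * N + 1"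
      using deg by (simp add: degree_mult_eq)
    then have "2 * degree (Q n) = n * (n + 1)"
      using N k 3 by simp
    moreover have "lead_coeff (Q n) = 1"
      using lead lck by (simp only: lead_coeff_mult) simp
    ultimately show ?thesis by simp
  qed
qed

section \<open>Second differences in \<open>n\<close> and the recurrence for them\<close>

context
  fixes Q assumes Q: "yablonskii_vorobev Q"
begin

text \<open>
  Second differences are centred at \<open>n + 1\<close>, so that they and \<open>toda_coeff\<close> are defined for all \<open>n\<close>.
\<close>
definition second_diff :: "nat \<Rightarrow> nat \<Rightarrow> complex" where
  "second_diff m n = root_power_sum Q (Suc (Suc n)) m - 2 * root_power_sum Q (Suc n) m
     + root_power_sum Q n m"

definition toda_coeff :: "nat \<Rightarrow> nat \<Rightarrow> complex" where
  "toda_coeff m n = toda_fps (power_sum_fps (proots (Q (Suc n)))) $ m"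

lemma toda_coeff_eq:
  "m > 0 \<Longrightarrow> toda_coeff m n =
     (if m < 3 then 0 else 4 * of_nat (m - 2) * root_power_sum Q (Suc n) (m - 3))"
  by (simp add: toda_coeff_def toda_fps_nth root_power_sum_def)

lemma root_power_sum_0: "root_power_sum Q n 0 = of_nat n * (of_nat n + 1) / 2"
proof -
  have "2 * size (proots (Q n)) = n * (n + 1)"
    using yablonskii_vorobev_degree[OF Q, of n] by (simp add: size_proots_complex)
  from arg_cong[OF this, of "of_nat :: nat \<Rightarrow> complex"] show ?thesis
    by (simp add: root_power_sum_def field_simps)
qed

lemma second_diff_0: "second_diff 0 n = 1"
  by (simp add: second_diff_def root_power_sum_0 field_simps)

lemma second_diff_rec:
  assumes "m > 0"
  shows "second_diff m n = - of_nat m * toda_coeff m n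
    - (\<Sum>j\<in>{1..<m}. toda_coeff j n * second_diff (m - j) n)"
proof -
  have "Q (Suc (Suc n)) * Q n = [:0, 1:] * (Q (Suc n))\<^sup>2
      - 4 * (Q (Suc n) * pderiv (pderiv (Q (Suc n))) - (pderiv (Q (Suc n)))\<^sup>2)"
    using Q unfolding yablonskii_vorobev_def by (metis Suc_eq_plus1 diff_Suc_1 le_add2)
  moreover have "lead_coeff (Q k) = 1" for k
    using yablonskii_vorobev_degree[OF Q] by blast
  ultimately show ?thesis
    using second_diff_0[of n]
    unfolding second_diff_def root_power_sum_def toda_coeff_def
    by (intro toda_power_sum assms)
qed

text \<open>If 3 does not divide \<open>m\<close>, then every term of the recurrence has a factor
  whose index is not divisible by 3. By induction the second difference vanishes, so the initial
  values decide.\<close>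

lemma root_power_sum_not_dvd_3:
  assumes "\<not> 3 dvd m"
  shows "root_power_sum Q n m = 0"
  using assms
proof (induction m arbitrary: n rule: less_induct)
  case (less m)
  have m: "m > 0" using less.prems by (intro gr0I) auto
  have coeff: "toda_coeff j n = 0" if "\<not> 3 dvd j" "j \<le> m" for j n
  proof (cases "j < 3")
    case True
    moreover have "j > 0" using that(1) by (intro gr0I) auto
    ultimately show ?thesis by (simp add: toda_coeff_eq)
  next
    case False
    then have "\<not> 3 dvd (j - 3)"
      using that(1) by presburger
    then show ?thesis
      using less.IH[of "j - 3"] that False by (simp add: toda_coeff_eq)
  qed
  have prod: "toda_coeff j n * second_diff (m - j) n = 0" if "j \<in> {1..<m}" for j n
  proof (cases "3 dvd j")
    case True
    moreover have "j < m" using that by simp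
    ultimately have "\<not> 3 dvd (m - j)"
      using less.prems by presburger
    then show ?thesis
      using less.IH[of "m - j"] that m by (simp add: second_diff_def)
  qed (use coeff that in auto)
  have "(\<Sum>j\<in>{1..<m}. toda_coeff j n * second_diff (m - j) n) = 0" for n
    by (intro sum.neutral ballI prod)
  then have diff: "second_diff m n = 0" for n
    using second_diff_rec[OF m] coeff less.prems by simp
  \<comment> \<open>Two consecutive values are carried along because the recursion in
    \<open>n\<close> has order two. \<open>Q 0\<close> has no roots, and the only root of
    \<open>Q 1\<close> is 0.\<close>
  have "root_power_sum Q n m = 0 \<and> root_power_sum Q (Suc n) m = 0"
  proof (induction n)
    case 0
    show ?case
      using Q m by (simp add: yablonskii_vorobev_def root_power_sum_def power_sum_def)
  next
    case (Suc n)
    then show ?case using diff[of n] by (simp add: second_diff_def)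
  qed
  then show ?case ..
qed

lemma second_diff_rec_3:
  assumes "l > 0"
  shows "second_diff (3 * l) n = - of_nat (3 * l) * toda_coeff (3 * l) n
    - (\<Sum>i\<in>{1..<l}. toda_coeff (3 * i) n * second_diff (3 * (l - i)) n)"
proof -
  have "(\<Sum>j\<in>{1..<3 * l}. toda_coeff j n * second_diff (3 * l - j) n)
      = (\<Sum>j\<in>(*) 3 ` {1..<l}. toda_coeff j n * second_diff (3 * l - j) n)"
  proof (rule sum.mono_neutral_right)
    show "\<forall>j\<in>{1..<3 * l} - (*) 3 ` {1..<l}.
        toda_coeff j n * second_diff (3 * l - j) n = 0"
    proof
      fix j assume j: "j \<in> {1..<3 * l} - (*) 3 ` {1..<l}"
      have "\<not> 3 dvd j"
      proof
        assume "3 dvd j"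
        then obtain i where "j = 3 * i" by blast
        then show False using j by auto
      qed
      then have "\<not> 3 dvd (3 * l - j)"
        using j by (metis DiffD1 atLeastLessThan_iff dvd_diffD1 dvd_triv_left less_imp_le_nat)
      then show "toda_coeff j n * second_diff (3 * l - j) n = 0"
        by (simp add: second_diff_def root_power_sum_not_dvd_3)
    qed
  qed auto
  also have "\<dots> = (\<Sum>i\<in>{1..<l}. toda_coeff (3 * i) n * second_diff (3 * (l - i)) n)"
    by (subst sum.reindex) (auto simp: inj_on_def diff_mult_distrib2)
  finally show ?thesis
    using second_diff_rec[of "3 * l" n] assms by simp
qed

text \<open>The constant is \<open>4 (m - 2)\<close> at \<open>m = 3 (l + 1)\<close>.\<close>

lemma poly_seq_toda_coeff:
  assumes "poly_seq (2 * l + 2) c (\<lambda>n. root_power_sum Q n (3 * l))"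
  shows "poly_seq (2 * Suc l) (of_nat (4 * (3 * l + 1)) * c) (toda_coeff (3 * Suc l))"
proof -
  have "toda_coeff (3 * Suc l) = (\<lambda>n. of_nat (4 * (3 * l + 1)) * root_power_sum Q (Suc n) (3 * l))"
    by (rule ext) (simp add: toda_coeff_eq algebra_simps)
  then show ?thesis
    using poly_seq_cmult[OF poly_seq_shift[OF assms]] by simp
qed

text \<open>Power sums and second differences are treated in one induction: the second difference at
  \<open>l\<close> depends on both for smaller indices, and the power sum at \<open>l\<close> arises
  from it by summing twice. The condition \<open>r > 0\<close> records the exact degree.\<close>

lemma poly_seq_root_power_sum:
  "\<exists>r > 0. poly_seq (2 * l + 2) ((-1) ^ l * of_real r) (\<lambda>n. root_power_sum Q n (3 * l))"
proof -
  have "(\<exists>r > 0. poly_seq (2 * l + 2) ((-1) ^ l * of_real r) (\<lambda>n. root_power_sum Q n (3 * l))) \<and>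
    (\<exists>r > 0. poly_seq (2 * l) ((-1) ^ l * of_real r) (second_diff (3 * l)))"
  proof (induction l rule: less_induct)
    case (less l)
    obtain r where r: "r > 0" "poly_seq (2 * l) ((-1) ^ l * of_real r) (second_diff (3 * l))"
    proof (cases "l = 0")
      case True
      then show ?thesis
        using that[of 1] poly_seq_const[of 1] by (simp add: second_diff_0[abs_def])
    next
      case False
      \<comment> \<open>The exponent is \<open>i - 1\<close> because
        \<open>toda_coeff (3 * i)\<close> comes from the power sums of index
        \<open>3 * (i - 1)\<close>. Hence \<open>i = l\<close> is already covered by the induction
        hypothesis.\<close>
      have "\<forall>i\<in>{1..l}. \<exists>u>0. poly_seq (2 * i) ((-1) ^ (i - 1) * of_real u) (toda_coeff (3 * i))"
      proof
        fix i assume i: "i \<in> {1..l}"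
        then obtain k where k: "i = Suc k" "k < l" by (cases i) auto
        obtain u where u: "u > 0"
          "poly_seq (2 * k + 2) ((-1) ^ k * of_real u) (\<lambda>n. root_power_sum Q n (3 * k))"
          using less.IH[OF k(2)] by blast
        have "poly_seq (2 * i) ((-1) ^ (i - 1) * of_real (real (4 * (3 * k + 1)) * u))
            (toda_coeff (3 * i))"
          using poly_seq_toda_coeff[OF u(2)] by (simp add: k(1) mult_ac)
        moreover have "real (4 * (3 * k + 1)) * u > 0"
          using u(1) by simp
        ultimately show "\<exists>u>0. poly_seq (2 * i) ((-1) ^ (i - 1) * of_real u) (toda_coeff (3 * i))"
          by blast
      qed
      then obtain u where u: "\<And>i. i \<in> {1..l} \<Longrightarrow> u i > 0"
        "\<And>i. i \<in> {1..l} \<Longrightarrow> poly_seq (2 * i) ((-1) ^ (i - 1) * of_real (u i)) (toda_coeff (3 * i))"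
        by metis
      obtain v where v: "\<And>i. i < l \<Longrightarrow> v i > 0"
        "\<And>i. i < l \<Longrightarrow> poly_seq (2 * i) ((-1) ^ i * of_real (v i)) (second_diff (3 * i))"
        using less.IH by metis
      \<comment> \<open>All terms of the recurrence have leading sign \<open>(-1) ^ l\<close>, so their moduli add up.\<close>
      define w where "w = real (3 * l) * u l + (\<Sum>i\<in>{1..<l}. u i * v (l - i))"
      have "w > 0"
        \<comment> \<open>Positivity comes from the first summand, since the sum is empty for
          \<open>l = 1\<close>.\<close>
        unfolding w_def using False u(1) v(1)
        by (intro add_pos_nonneg sum_nonneg mult_pos_pos mult_nonneg_nonneg) (auto intro: less_imp_le)
      have 1: "poly_seq (2 * l) (- of_nat (3 * l) * ((-1) ^ (l - 1) * of_real (u l)))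
          (\<lambda>n. - of_nat (3 * l) * toda_coeff (3 * l) n)"
        using False by (intro poly_seq_cmult u(2)) auto
      have 2: "poly_seq (2 * l)
          (- 1 * (((-1) ^ (i - 1) * of_real (u i)) * ((-1) ^ (l - i) * of_real (v (l - i)))))
          (\<lambda>n. - 1 * (toda_coeff (3 * i) n * second_diff (3 * (l - i)) n))" if "i \<in> {1..<l}" for i
      proof -
        have "2 * i + 2 * (l - i) = 2 * l" using that by auto
        then show ?thesis
          using poly_seq_cmult[OF poly_seq_mult[OF u(2)[of i] v(2)[of "l - i"]], of "-1"] that
          by auto
      qed
      have diff: "second_diff (3 * l) = (\<lambda>n. - of_nat (3 * l) * toda_coeff (3 * l) n
          + (\<Sum>i\<in>{1..<l}. - 1 * (toda_coeff (3 * i) n * second_diff (3 * (l - i)) n)))"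
        using second_diff_rec_3 False by (auto simp: sum_negf)
      have coeff: "- of_nat (3 * l) * ((-1) ^ (l - 1) * of_real (u l))
          + (\<Sum>i\<in>{1..<l}.
              - 1 * (((-1) ^ (i - 1) * of_real (u i)) * ((-1) ^ (l - i) * of_real (v (l - i)))))
          = ((-1) ^ l * of_real w :: complex)"
      proof -
        have "- 1 * (((-1) ^ (i - 1) * of_real (u i)) * ((-1) ^ (l - i) * of_real (v (l - i))))
            = ((-1) ^ l * of_real (u i * v (l - i)) :: complex)" if "i \<in> {1..<l}" for i
        proof -
          have "l = Suc ((i - 1) + (l - i))" using that by auto
          then have "(-1 :: complex) ^ l = - ((-1) ^ (i - 1) * (-1) ^ (l - i))"
            by (metis power_Suc power_add mult_minus1)
          then show ?thesis by simp
        qed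
        then have sum: "(\<Sum>i\<in>{1..<l}.
              - 1 * (((-1) ^ (i - 1) * of_real (u i)) * ((-1) ^ (l - i) * of_real (v (l - i)))))
            = (-1) ^ l * (of_real (\<Sum>i\<in>{1..<l}. u i * v (l - i)) :: complex)"
          unfolding of_real_sum sum_distrib_left by (rule sum.cong[OF refl])
        have "- of_nat (3 * l) * ((-1) ^ (l - 1) * of_real (u l))
            = ((-1) ^ l * of_real (real (3 * l) * u l) :: complex)"
          using False by (cases l) (simp_all add: algebra_simps)
        then show ?thesis
          unfolding w_def of_real_add distrib_left sum by (rule arg_cong)
      qed
      have "poly_seq (2 * l) ((-1) ^ l * of_real w) (second_diff (3 * l))"
        unfolding diff coeff[symmetric] by (intro poly_seq_add poly_seq_sum 1 2 finite_atLeastLessThan)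
      then show ?thesis using that \<open>w > 0\<close> by blast
    qed
    have "second_diff (3 * l) = (\<lambda>n.
        (root_power_sum Q (Suc (Suc n)) (3 * l) - root_power_sum Q (Suc n) (3 * l))
        - (root_power_sum Q (Suc n) (3 * l) - root_power_sum Q n (3 * l)))"
      by (rule ext) (simp add: second_diff_def)
    \<comment> \<open>Each of the two summations raises the degree by one and divides the leading
      coefficient by the new degree.\<close>
    then have "poly_seq (Suc (Suc (2 * l)))
        ((-1) ^ l * of_real r / of_nat (Suc (2 * l)) / of_nat (Suc (Suc (2 * l))))
        (\<lambda>n. root_power_sum Q n (3 * l))"
      using r(2) by (intro poly_seq_antidifference) simp
    then have "poly_seq (2 * l + 2) ((-1) ^ l * of_real (r / real (Suc (2 * l)) / real (Suc (Suc (2 * l)))))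
        (\<lambda>n. root_power_sum Q n (3 * l))"
      by simp
    moreover have "r / real (Suc (2 * l)) / real (Suc (Suc (2 * l))) > 0"
      using r(1) by simp
    ultimately show ?case using r by blast
  qed
  then show ?thesis ..
qed

end

theorem theorem3p1:
  fixes Q :: "nat \<Rightarrow> complex poly"
  assumes "yablonskii_vorobev Q"
  shows "(\<forall>n\<ge>2. \<forall>m > n * (n + 1) div 2. no_new_information Q n m) \<and>
    (\<forall>l\<ge>1. \<exists>p :: complex poly. degree p = 2 * (l + 1) \<and>
       (\<forall>n. root_power_sum Q n (3 * l) = poly p (of_nat n)))"
proof (intro conjI allI impI)
  fix n m :: nat
  assume "n \<ge> 2" "m > n * (n + 1) div 2"
  then show "no_new_information Q n m"
    using yablonskii_vorobev_degree[OF assms, of n]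
    by (intro no_new_informationI) (auto simp: size_proots_complex)
next
  fix l :: nat
  assume "l \<ge> 1"
  obtain r p where "r > 0" "degree p \<le> 2 * l + 2" "coeff p (2 * l + 2) = (-1) ^ l * of_real r"
    "\<And>n. root_power_sum Q n (3 * l) = poly p (of_nat n)"
    using poly_seq_root_power_sum[OF assms, of l] unfolding poly_seq_def by blast
  \<comment> \<open>Since \<open>r > 0\<close>, the coefficient at \<open>2 * l + 2\<close> is
    nonzero, so the degree bound is attained.\<close>
  moreover from this have "degree p = 2 * (l + 1)"
    by (intro antisym le_degree) auto
  ultimately show "\<exists>p :: complex poly. degree p = 2 * (l + 1) \<and>
      (\<forall>n. root_power_sum Q n (3 * l) = poly p (of_nat n))"
    by blast
qed

end
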